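(* Let $P,a,b,\mathcal{X},\mathcal{U},F,x_{\mathrm{opt}}$ be as described in the context, with all standing assumptions there. Consider the pseudo-gradient dynamics $$\dot x(t)=\Pi_{\mathcal{X}}\big(x(t),-F(x(t))+u(t)\big).$$ Assume that $aP^\top x_{\mathrm{opt}}\in\mathcal{U}$ and $$\|aP\|<\tfrac12 .$$ Then, for any initial condition $x(0)\in\mathcal{X}$, the static feedback intervention $$u(t)=\mathrm{proj}_{\mathcal{U}}\big(aP^\top x(t)\big)$$ steers the action profile $x(t)$ to the social optimum $x_{\mathrm{opt}}$, i.e. $\lim_{t\to\infty}x(t)=x_{\mathrm{opt}}$.
   Context: Setting. $\mathcal{I}=\{1,\dots,n\}$; $P\in\mathbb{R}^{n\times n}$ with $P_{ij}\in[0,1]$ and $P_{ii}=0$; $a\in\mathbb{R}\setminus\{0\}$; $b\in\mathbb{R}^n$; $\mathcal{X}=\prod_{i\in\mathcal{I}}\mathcal{X}_i$ with $\mathcal{X}_i\subseteq\mathbb{R}$; $\mathcal{U}\subseteq\mathbb{R}^n$ (the intervention set). Notation. $\|\cdot\|$ is the Euclidean norm for vectors and the induced (spectral) norm for matrices. $\mathrm{proj}_{\mathcal{U}}(z)=\arg\min_{y\in\mathcal{U}}\|y-z\|$. $\mathcal{T}_{\mathcal{X}}(x)=\mathrm{cl}\big(\bigcup_{y\in\mathcal{X}}\bigcup_{\lambda>0}\lambda(y-x)\big)$ is the tangent cone at $x\in\mathcal{X}$; $\Pi_{\mathcal{X}}(x,z)$ is the Euclidean projection of $z$ onto $\mathcal{T}_{\mathcal{X}}(x)$.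 For a map $G:\mathcal{X}\to\mathbb{R}^n$, $\mathrm{SOL}(\mathcal{X},G)$ is the set of $\bar x\in\mathcal{X}$ with $(x-\bar x)^\top G(\bar x)\ge 0$ for all $x\in\mathcal{X}$; when it is a singleton it is identified with its element. Solutions of the differential equation are Carathéodory: absolutely continuous maps $x:[0,\infty)\to\mathcal{X}$ satisfying the equation for almost all $t\ge 0$. Maps. $F(x)=(I-aP)x-b$ and $H(x)=\big(I-a(P+P^\top)\big)x-b$. Standing assumptions. (1) Each $\mathcal{X}_i$ and $\mathcal{U}$ are nonempty, closed and convex, and $\bm{0}\in\mathcal{U}$. (2) $\max_{i\in\mathcal{I}}a\,\lambda_i(P+P^\top)<1$, where $\lambda_i(\cdot)$ are the eigenvalues. Under (1),(2) the social optimum $x_{\mathrm{opt}}$ is defined as the unique element of $\mathrm{SOL}(\mathcal{X},H)$; equivalently it is the unique maximizer over $\mathcal{X}$ of $\sum_{i}\big(-\tfrac12x_i^2+x_i(a\sum_jP_{ij}x_j+b_i)\big)$. (3) $x_{\mathrm{opt}}\in\mathcal{S}:=\{\bar x\in\mathcal{X}:\exists\,\bar u\in\mathcal{U}\text{ such that }\bar x=\mathrm{SOL}(\mathcal{X},F-\bar u)\}$. *)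

theory Defs
  imports "HOL-Analysis.Analysis"
begin

definition action_space :: "('n::finite \<Rightarrow> real set) \<Rightarrow> (real^'n) set" where
  "action_space Xi = {x. \<forall>i. x $ i \<in> Xi i}"

(* Only applied to symmetric matrices below, for which every eigenvalue is real. *)
definition eigenvalues :: "real^'n^'n \<Rightarrow> real set" where
  "eigenvalues A = {l. \<exists>v. v \<noteq> 0 \<and> A *v v = l *\<^sub>R v}"

definition spectral_norm :: "real^'n^'n \<Rightarrow> real" where
  "spectral_norm A = onorm ((*v) A)"

definition tangent_cone :: "'a::real_normed_vector set \<Rightarrow> 'a \<Rightarrow> 'a set" where
  "tangent_cone X x = closure (\<Union>y\<in>X. \<Union>l\<in>{0<..}. {l *\<^sub>R (y - x)})"

(* closest_point S z is the minimizer over S of the distance to z; it is unique for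
   nonempty closed convex S, which is the only case in which it is used below. *)
definition proj_tangent :: "(real^'n) set \<Rightarrow> real^'n \<Rightarrow> real^'n \<Rightarrow> real^'n" where
  "proj_tangent X x z = closest_point (tangent_cone X x) z"

definition SOL :: "(real^'n) set \<Rightarrow> (real^'n \<Rightarrow> real^'n) \<Rightarrow> (real^'n) set" where
  "SOL X G = {xb \<in> X. \<forall>x\<in>X. 0 \<le> (x - xb) \<bullet> G xb}"

definition Fmap :: "real \<Rightarrow> real^'n^'n \<Rightarrow> real^'n \<Rightarrow> real^'n \<Rightarrow> real^'n" where
  "Fmap a P b x = (mat 1 - a *\<^sub>R P) *v x - b"

definition Hmap :: "real \<Rightarrow> real^'n^'n \<Rightarrow> real^'n \<Rightarrow> real^'n \<Rightarrow> real^'n" where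
  "Hmap a P b x = (mat 1 - a *\<^sub>R (P + transpose P)) *v x - b"

definition social_optimum ::
    "real \<Rightarrow> real^'n^'n \<Rightarrow> real^'n \<Rightarrow> (real^'n) set \<Rightarrow> real^'n" where
  "social_optimum a P b X = the_elem (SOL X (Hmap a P b))"

definition steerable_set ::
    "real \<Rightarrow> real^'n^'n \<Rightarrow> real^'n \<Rightarrow> (real^'n) set \<Rightarrow> (real^'n) set \<Rightarrow> (real^'n) set" where
  "steerable_set a P b X U = {xb \<in> X. \<exists>ub\<in>U. SOL X (\<lambda>x. Fmap a P b x - ub) = {xb}}"

(* Absolute continuity (epsilon-delta) on a real interval S; a finite family of
   nonoverlapping compact subintervals of S is a division D of its own union,
   and K = {Inf K..Sup K} for each K in D. *)
definition absolutely_continuous_on ::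
    "real set \<Rightarrow> (real \<Rightarrow> 'a::real_normed_vector) \<Rightarrow> bool" where
  "absolutely_continuous_on S f \<longleftrightarrow>
     (\<forall>e>0. \<exists>d>0. \<forall>D. D division_of \<Union>D \<and> \<Union>D \<subseteq> S \<and> (\<Sum>K\<in>D. Sup K - Inf K) < d
        \<longrightarrow> (\<Sum>K\<in>D. norm (f (Sup K) - f (Inf K))) < e)"

(* On the unbounded time axis, absolute continuity means absolute continuity on
   every compact interval {0..T}. *)
definition pseudo_gradient_solution ::
    "real \<Rightarrow> real^'n^'n \<Rightarrow> real^'n \<Rightarrow> (real^'n) set \<Rightarrow> (real \<Rightarrow> real^'n) \<Rightarrow> (real \<Rightarrow> real^'n) \<Rightarrow> bool"
  where
  "pseudo_gradient_solution a P b X u x \<longleftrightarrow>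
     (\<forall>t\<ge>0. x t \<in> X) \<and>
     (\<forall>T\<ge>0. absolutely_continuous_on {0..T} x) \<and>
     (AE t in lebesgue. 0 \<le> t \<longrightarrow>
        (x has_vector_derivative proj_tangent X (x t) (- Fmap a P b (x t) + u t))
          (at t within {0..}))"

end

(* The squared distance W = |x - x_opt|^2 decays at rate 2 (1 - 2 |aP|). Projecting the velocity
   onto the tangent cone only increases its component towards x_opt, which is a point of X. Adding
   the variational inequality of x_opt, read as an equilibrium condition for F with the constant
   input a P^T x_opt (fixed by the projection onto U), compares -F + u at x and at x_opt: the
   identity part of F contributes -W, while aP and the nonexpansive feedback contribute at most
   |aP| W each. Since solutions are only differentiable almost everywhere, decay of W comes from an
   increment bound for absolutely continuous functions, proved by covering the exceptional null set
   in a gauge-fine division. *)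
theory Submission
  imports Defs
begin

section \<open>Absolute continuity: consequences and transfer to the squared distance\<close>

lemma absolutely_continuous_onE:
  assumes "absolutely_continuous_on S f" "e > 0"
  obtains d where "d > 0"
    "\<And>D. D division_of \<Union>D \<Longrightarrow> \<Union>D \<subseteq> S \<Longrightarrow> (\<Sum>K\<in>D. Sup K - Inf K) < d
      \<Longrightarrow> (\<Sum>K\<in>D. norm (f (Sup K) - f (Inf K))) < e"
proof -
  obtain d where "d > 0" and d: "\<forall>D. D division_of \<Union>D \<and> \<Union>D \<subseteq> S \<and> (\<Sum>K\<in>D. Sup K - Inf K) < d
      \<longrightarrow> (\<Sum>K\<in>D. norm (f (Sup K) - f (Inf K))) < e"
    using assms(1)[unfolded absolutely_continuous_on_def, rule_format, OF assms(2)] by (elim exE conjE)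
  then show thesis
    by (intro that[of d]) simp_all
qed

text \<open>One interval is a division of itself, so the definition contains uniform continuity as
  its one-piece case.\<close>

lemma absolutely_continuous_onD_interval:
  assumes "absolutely_continuous_on S f" "e > 0"
  obtains d where "d > 0"
    "\<And>u v. u \<le> v \<Longrightarrow> {u..v} \<subseteq> S \<Longrightarrow> v - u < d \<Longrightarrow> norm (f v - f u) < e"
proof -
  obtain d where "d > 0" and d: "\<And>D. D division_of \<Union>D \<Longrightarrow> \<Union>D \<subseteq> S \<Longrightarrow> (\<Sum>K\<in>D. Sup K - Inf K) < d
      \<Longrightarrow> (\<Sum>K\<in>D. norm (f (Sup K) - f (Inf K))) < e"
    by (rule absolutely_continuous_onE[OF assms]) (rule that)
  have "norm (f v - f u) < e" if "u \<le> v" "{u..v} \<subseteq> S" "v - u < d" for u v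
  proof -
    have "{{u..v}} division_of \<Union>{{u..v}}"
      using division_of_self[of u v] that by simp
    from d[OF this] show ?thesis
      using that by simp
  qed
  with \<open>d > 0\<close> show thesis
    using that by blast
qed

lemma absolutely_continuous_on_imp_continuous_on:
  assumes "absolutely_continuous_on {a..b} f"
  shows "continuous_on {a..b} f"
  unfolding continuous_on_iff
proof (intro ballI allI impI)
  fix t and e :: real
  assume t: "t \<in> {a..b}" and "e > 0"
  obtain d where "d > 0" and d: "\<And>u v. u \<le> v \<Longrightarrow> {u..v} \<subseteq> {a..b} \<Longrightarrow> v - u < d \<Longrightarrow> norm (f v - f u) < e"
    by (rule absolutely_continuous_onD_interval[OF assms \<open>e > 0\<close>]) (rule that)
  have "dist (f s) (f t) < e" if "s \<in> {a..b}" "dist s t < d" for s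
  proof (cases "s \<le> t")
    case True
    then show ?thesis
      using d[of s t] t that by (auto simp: dist_norm norm_minus_commute)
  next
    case False
    then show ?thesis
      using d[of t s] t that by (auto simp: dist_norm)
  qed
  then show "\<exists>d>0. \<forall>s\<in>{a..b}. dist s t < d \<longrightarrow> dist (f s) (f t) < e"
    using \<open>d > 0\<close> by blast
qed

text \<open>The endpoints of every piece of a division lie in \<open>S\<close>, so the increment
  bound applies piece by piece and \<open>e / L\<close> for \<open>f\<close> yields \<open>e\<close>
  for \<open>g\<close>.\<close>

lemma absolutely_continuous_on_dominated:
  assumes f: "absolutely_continuous_on S f" and "L > 0"
    and le: "\<And>u v. u \<in> S \<Longrightarrow> v \<in> S \<Longrightarrow> norm (g v - g u) \<le> L * norm (f v - f u)"
  shows "absolutely_continuous_on S g"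
  unfolding absolutely_continuous_on_def
proof (intro allI impI)
  fix e :: real
  assume "e > 0"
  then have eL: "e / L > 0"
    using \<open>L > 0\<close> by simp
  obtain d where "d > 0" and d: "\<And>D. D division_of \<Union>D \<Longrightarrow> \<Union>D \<subseteq> S \<Longrightarrow> (\<Sum>K\<in>D. Sup K - Inf K) < d
      \<Longrightarrow> (\<Sum>K\<in>D. norm (f (Sup K) - f (Inf K))) < e / L"
    by (rule absolutely_continuous_onE[OF f eL]) (rule that)
  have "(\<Sum>K\<in>D. norm (g (Sup K) - g (Inf K))) < e"
    if D: "D division_of \<Union>D" "\<Union>D \<subseteq> S" "(\<Sum>K\<in>D. Sup K - Inf K) < d" for D
  proof -
    have "norm (g (Sup K) - g (Inf K)) \<le> L * norm (f (Sup K) - f (Inf K))" if K_in: "K \<in> D" for K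
    proof -
      obtain u v where K: "K = {u..v}" "u \<le> v"
        using division_ofD(3,4)[OF D(1) K_in] by (auto simp: box_real)
      have "u \<in> K" "v \<in> K"
        using K by auto
      then have "u \<in> S" "v \<in> S"
        using K_in D(2) by auto
      then show ?thesis
        using le[of u v] K by auto
    qed
    then have "(\<Sum>K\<in>D. norm (g (Sup K) - g (Inf K))) \<le> L * (\<Sum>K\<in>D. norm (f (Sup K) - f (Inf K)))"
      by (simp add: sum_distrib_left sum_mono)
    also have "\<dots> < L * (e / L)"
      using d[OF D] \<open>L > 0\<close> by (intro mult_strict_left_mono) auto
    finally show ?thesis
      using \<open>L > 0\<close> by simp
  qed
  then show "\<exists>d>0. \<forall>D. D division_of \<Union>D \<and> \<Union>D \<subseteq> S \<and> (\<Sum>K\<in>D. Sup K - Inf K) < d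
      \<longrightarrow> (\<Sum>K\<in>D. norm (g (Sup K) - g (Inf K))) < e"
    using \<open>d > 0\<close> by blast
qed

text \<open>On a compact interval the distance to \<open>z\<close> is bounded by some
  \<open>B\<close>, and squaring is Lipschitz with constant \<open>2 * B\<close> on
  \<open>{0..B}\<close>.\<close>

lemma absolutely_continuous_on_norm_diff_squared:
  assumes "absolutely_continuous_on {a..b} f"
  shows "absolutely_continuous_on {a..b} (\<lambda>t. (norm (f t - z))\<^sup>2)"
proof -
  have "compact ((\<lambda>t. f t - z) ` {a..b})"
    using absolutely_continuous_on_imp_continuous_on[OF assms]
    by (intro compact_continuous_image continuous_intros) auto
  then obtain B where "B > 0" and B: "\<And>t. t \<in> {a..b} \<Longrightarrow> norm (f t - z) \<le> B"
    using compact_imp_bounded bounded_pos by (metis imageI)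
  show ?thesis
  proof (rule absolutely_continuous_on_dominated[OF assms])
    show "2 * B > 0"
      using \<open>B > 0\<close> by simp
    fix u v
    assume uv: "u \<in> {a..b}" "v \<in> {a..b}"
    have "\<bar>(norm (f v - z))\<^sup>2 - (norm (f u - z))\<^sup>2\<bar>
        = \<bar>norm (f v - z) - norm (f u - z)\<bar> * (norm (f v - z) + norm (f u - z))"
      by (simp add: power2_eq_square square_diff_square_factored abs_mult)
    also have "\<dots> \<le> norm (f v - f u) * (2 * B)"
      using B[OF uv(1)] B[OF uv(2)] norm_triangle_ineq3[of "f v - z" "f u - z"]
      by (intro mult_mono) auto
    finally show "norm ((norm (f v - z))\<^sup>2 - (norm (f u - z))\<^sup>2) \<le> 2 * B * norm (f v - f u)"
      by (simp add: mult.commute)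
  qed
qed

section \<open>Increments of absolutely continuous functions\<close>

text \<open>The exceptional null set is covered by an open set of small measure, so in a fine tagged
  division the intervals tagged by it contribute little by absolute continuity; the remaining
  increments are controlled by the derivative at the tag.\<close>
lemma absolutely_continuous_on_increment_le:
  fixes f :: "real \<Rightarrow> real"
  assumes "a \<le> b" and ac: "absolutely_continuous_on {a..b} f"
    and ae: "AE t in lebesgue. t \<in> {a..b} \<longrightarrow>
      (\<exists>D. (f has_real_derivative D) (at t within {a..b}) \<and> D \<le> m)"
  shows "f b - f a \<le> m * (b - a)"
proof (rule field_le_epsilon)
  fix e0 :: real
  assume "e0 > 0"
  \<comment> \<open>The error budget is \<open>e * (b - a)\<close> for intervals with regular tags
    and \<open>2 * e\<close> for those tagged in the null set.\<close>
  define e where "e = e0 / (b - a + 2)"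
  have "e > 0"
    using \<open>e0 > 0\<close> \<open>a \<le> b\<close> by (simp add: e_def)
  define Q where "Q t \<longleftrightarrow> (\<exists>D. (f has_real_derivative D) (at t within {a..b}) \<and> D \<le> m)" for t
  obtain N where N: "N \<in> null_sets lebesgue" and "{t \<in> space lebesgue. \<not> (t \<in> {a..b} \<longrightarrow> Q t)} \<subseteq> N"
    using ae unfolding Q_def[symmetric] eventually_ae_filter by blast
  then have der: "\<And>t. t \<in> {a..b} \<Longrightarrow> t \<notin> N \<Longrightarrow> Q t"
    by auto
  obtain d0 where "d0 > 0" and d0: "\<And>D. D division_of \<Union>D \<Longrightarrow> \<Union>D \<subseteq> {a..b} \<Longrightarrow> (\<Sum>K\<in>D. Sup K - Inf K) < d0
      \<Longrightarrow> (\<Sum>K\<in>D. norm (f (Sup K) - f (Inf K))) < e"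
    by (rule absolutely_continuous_onE[OF ac \<open>e > 0\<close>]) (rule that)
  \<comment> \<open>The first bound controls the increments of \<open>f\<close> over a set of total
    length below \<open>d\<close>, the second those of the linear function
    \<open>m * t\<close>.\<close>
  define d where "d = min d0 (e / (\<bar>m\<bar> + 1))"
  have "d > 0"
    using \<open>d0 > 0\<close> \<open>e > 0\<close> by (simp add: d_def add_nonneg_pos)
  have "\<bar>m\<bar> * d \<le> (\<bar>m\<bar> + 1) * (e / (\<bar>m\<bar> + 1))"
    using \<open>d > 0\<close> by (intro mult_mono) (auto simp: d_def)
  also have "\<dots> = e"
    by simp
  finally have md: "\<bar>m\<bar> * d \<le> e" .
  obtain G where G: "open G" "N \<subseteq> G" "G - N \<in> lmeasurable" "emeasure lebesgue (G - N) < ennreal d"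
    using sets_lebesgue_outer_open[OF null_setsD2[OF N] \<open>d > 0\<close>] by blast
  have G_meas: "G \<in> lmeasurable"
  proof -
    have "(G - N) \<union> N \<in> lmeasurable"
      using fmeasurable.Un[OF G(3) fmeasurableI_null_sets[OF N]] .
    then show ?thesis
      using \<open>N \<subseteq> G\<close> by (simp add: Un_absorb2)
  qed
  have "measure lebesgue G = measure lebesgue (G - N)"
    using G_meas N by (simp add: measure_Diff_null_set fmeasurableD)
  then have G_less: "measure lebesgue G < d"
    using G(3,4) \<open>d > 0\<close> by (simp add: emeasure_eq_measure2 ennreal_less_iff)

  \<comment> \<open>Choice of the gauge: balls around exceptional points stay inside
    \<open>G\<close>; around regular points the derivative controls increments over intervals
    containing the tag.\<close>
  have "\<exists>r>0. (t \<in> N \<longrightarrow> ball t r \<subseteq> G) \<and>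
      (t \<in> {a..b} - N \<longrightarrow> (\<forall>u\<in>{a..b}. \<forall>v\<in>{a..b}. u \<in> ball t r \<longrightarrow> v \<in> ball t r \<longrightarrow> u \<le> t \<longrightarrow> t \<le> v
         \<longrightarrow> f v - f u \<le> (m + e) * (v - u)))" for t
  proof (cases "t \<in> {a..b} - N")
    case True
    then obtain D where D: "(f has_real_derivative D) (at t within {a..b})" "D \<le> m"
      using der[of t] by (auto simp: Q_def)
    then obtain r where "r > 0" and r: "\<And>y. y \<in> {a..b} \<Longrightarrow> norm (y - t) < r
        \<Longrightarrow> norm (f y - f t - D * (y - t)) \<le> e * norm (y - t)"
      using \<open>e > 0\<close> unfolding has_field_derivative_def has_derivative_within_alt by metis
    have "f v - f u \<le> (m + e) * (v - u)"
      if "u \<in> {a..b}" "v \<in> {a..b}" "u \<in> ball t r" "v \<in> ball t r" "u \<le> t" "t \<le> v" for u v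
    proof -
      have "norm (f u - f t - D * (u - t)) \<le> e * norm (u - t)"
           "norm (f v - f t - D * (v - t)) \<le> e * norm (v - t)"
        using r[of u] r[of v] that by (auto simp: dist_norm norm_minus_commute)
      \<comment> \<open>Since \<open>u \<le> t \<le> v\<close>, the two error terms add up to
        exactly \<open>e * (v - u)\<close>.\<close>
      then have "f v - f u \<le> D * (v - u) + e * (v - u)"
        using that by (simp add: algebra_simps abs_le_iff)
      also have "\<dots> \<le> (m + e) * (v - u)"
        using mult_right_mono[OF D(2), of "v - u"] that by (simp add: distrib_right)
      finally show ?thesis .
    qed
    then show ?thesis
      using \<open>r > 0\<close> True by blast
  next
    case False
    show ?thesis
    proof (cases "t \<in> N")
      case True
      then obtain r where "r > 0" "ball t r \<subseteq> G"
        using G(1,2) open_contains_ball by blast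
      then show ?thesis
        using False by blast
    next
      case False
      \<comment> \<open>Here \<open>t\<close> lies outside both \<open>N\<close> and
        \<open>{a..b}\<close>, so both conditions are vacuous and radius 1 serves.\<close>
      then show ?thesis
        using \<open>t \<notin> {a..b} - N\<close> zero_less_one by blast
    qed
  qed
  then obtain r where r: "\<And>t. r t > 0" and rN: "\<And>t. t \<in> N \<Longrightarrow> ball t (r t) \<subseteq> G"
    and rder: "\<And>t u v. t \<in> {a..b} - N \<Longrightarrow> u \<in> {a..b} \<Longrightarrow> v \<in> {a..b} \<Longrightarrow> u \<in> ball t (r t) \<Longrightarrow>
        v \<in> ball t (r t) \<Longrightarrow> u \<le> t \<Longrightarrow> t \<le> v \<Longrightarrow> f v - f u \<le> (m + e) * (v - u)"
    by metis
  have "gauge (\<lambda>t. ball t (r t))"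
    using r by (intro gauge_ball_dependent) auto
  then obtain p where p: "p tagged_division_of {a..b}" and fine: "(\<lambda>t. ball t (r t)) fine p"
    using fine_division_exists_real by blast
  note pD = tagged_division_ofD[OF p]
  define q where "q = {(t,K) \<in> p. t \<in> N}"
  have "q \<subseteq> p" and "finite p"
    using pD(1) by (auto simp: q_def)
  have K: "\<exists>u v. K = {u..v} \<and> u \<le> t \<and> t \<le> v \<and> {u..v} \<subseteq> {a..b} \<and> {u..v} \<subseteq> ball t (r t)"
    if "(t,K) \<in> p" for t K
    using pD(2-4)[OF that] fine that unfolding fine_def by (fastforce simp: box_real)

  have q: "q tagged_partial_division_of {a..b}"
    using p \<open>q \<subseteq> p\<close> tagged_partial_division_subset unfolding tagged_division_of_def by blast
  have div: "snd ` q division_of \<Union>(snd ` q)"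
    by (rule partial_division_of_tagged_division[OF q])
  \<comment> \<open>The exceptional intervals do not overlap and lie in \<open>G\<close>, so their
    total length is at most the measure of \<open>G\<close>.\<close>
  have "(\<Sum>K\<in>snd ` q. Sup K - Inf K) = (\<Sum>K\<in>snd ` q. measure lebesgue K)"
    using K \<open>q \<subseteq> p\<close> by (intro sum.cong) fastforce+
  also have "\<dots> = measure lebesgue (\<Union>(snd ` q))"
    by (rule content_division[OF div])
  also have "\<dots> \<le> measure lebesgue G"
  proof (rule measure_mono_fmeasurable[OF _ _ G_meas])
    show "\<Union>(snd ` q) \<subseteq> G"
      using K rN by (fastforce simp: q_def)
    show "\<Union>(snd ` q) \<in> sets lebesgue"
      using lmeasurable_division[OF div] by (rule fmeasurableD)
  qed
  finally have len: "(\<Sum>K\<in>snd ` q. Sup K - Inf K) < d"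
    using G_less by simp
  moreover have "\<Union>(snd ` q) \<subseteq> {a..b}"
    using pD(3) \<open>q \<subseteq> p\<close> by fastforce
  ultimately have less_e: "(\<Sum>K\<in>snd ` q. norm (f (Sup K) - f (Inf K))) < e"
    using d0[OF div] by (simp add: d_def)

  let ?g = "\<lambda>t. f t - m * t"
  let ?\<Delta> = "\<lambda>K. ?g (Sup K) - ?g (Inf K)"
  have K_le: "Inf K \<le> Sup K" if "(t,K) \<in> p" for t K
    using K[OF that] by auto
  \<comment> \<open>Passing from tagged pairs to intervals needs a summand vanishing on every
    interval with empty interior. The guard covers the empty set, where \<open>Sup\<close> and
    \<open>Inf\<close> carry no information.\<close>
  have "(\<Sum>(t,K)\<in>q. ?\<Delta> K) = (\<Sum>(t,K)\<in>q. if K = {} then 0 else ?\<Delta> K)"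
    using pD(2) \<open>q \<subseteq> p\<close> by (intro sum.cong) fastforce+
  also have "\<dots> = (\<Sum>K\<in>snd ` q. if K = {} then 0 else ?\<Delta> K)"
  proof (rule sum.over_tagged_division_lemma[OF tagged_partial_division_of_Union_self[OF q]])
    fix u v :: real
    assume "box u v = {}"
    then show "(if cbox u v = {} then 0 else ?\<Delta> (cbox u v)) = 0"
      by (cases "u = v") (auto simp: box_real)
  qed
  also have "\<dots> = (\<Sum>K\<in>snd ` q. ?\<Delta> K)"
    using division_ofD(3)[OF div] by (intro sum.cong) auto
  also have "\<dots> \<le> (\<Sum>K\<in>snd ` q. norm (f (Sup K) - f (Inf K)) + \<bar>m\<bar> * (Sup K - Inf K))"
  proof (rule sum_mono)
    fix K
    assume "K \<in> snd ` q"
    then have "Inf K \<le> Sup K"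
      using K_le \<open>q \<subseteq> p\<close> by auto
    then have "- m * (Sup K - Inf K) \<le> \<bar>m\<bar> * (Sup K - Inf K)"
      by (intro mult_right_mono) auto
    then show "?\<Delta> K \<le> norm (f (Sup K) - f (Inf K)) + \<bar>m\<bar> * (Sup K - Inf K)"
      by (simp add: algebra_simps)
  qed
  also have "\<dots> = (\<Sum>K\<in>snd ` q. norm (f (Sup K) - f (Inf K))) + \<bar>m\<bar> * (\<Sum>K\<in>snd ` q. Sup K - Inf K)"
    by (simp add: sum.distrib sum_distrib_left)
  also have "\<dots> \<le> e + \<bar>m\<bar> * d"
    using less_e len by (intro add_mono mult_left_mono) auto
  finally have q_le: "(\<Sum>(t,K)\<in>q. ?\<Delta> K) \<le> 2 * e"
    using md by simp

  \<comment> \<open>At regular tags, subtracting \<open>m * t\<close> leaves only the error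
    \<open>e\<close> per unit length.\<close>
  have "(\<Sum>(t,K)\<in>p - q. ?\<Delta> K) \<le> (\<Sum>(t,K)\<in>p - q. e * (Sup K - Inf K))"
  proof (rule sum_mono, clarify)
    fix t K
    assume tK: "(t, K) \<in> p" "(t, K) \<notin> q"
    then obtain u v where uv: "K = {u..v}" "u \<le> t" "t \<le> v" "{u..v} \<subseteq> {a..b}" "{u..v} \<subseteq> ball t (r t)"
      using K by blast
    have "t \<in> {a..b} - N"
      using tK uv by (auto simp: q_def)
    then have "f v - f u \<le> (m + e) * (v - u)"
      using uv(2-4) subsetD[OF uv(5), of u] subsetD[OF uv(5), of v] by (intro rder) auto
    then show "?\<Delta> K \<le> e * (Sup K - Inf K)"
      using uv by (simp add: algebra_simps)
  qed
  \<comment> \<open>Enlarging the sum to all of \<open>p\<close> adds nonnegative terms, and the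
    total then telescopes.\<close>
  also have "\<dots> \<le> (\<Sum>(t,K)\<in>p. e * (Sup K - Inf K))"
    using \<open>finite p\<close> \<open>e > 0\<close> K_le by (intro sum_mono2) auto
  also have "\<dots> = e * (b - a)"
    using additive_tagged_division_1[OF \<open>a \<le> b\<close> p, of "\<lambda>t. e * t"] by (simp add: algebra_simps)
  finally have pq_le: "(\<Sum>(t,K)\<in>p - q. ?\<Delta> K) \<le> e * (b - a)" .

  have "?g b - ?g a = (\<Sum>(t,K)\<in>p. ?\<Delta> K)"
    using additive_tagged_division_1[OF \<open>a \<le> b\<close> p, of ?g] by simp
  also have "\<dots> = (\<Sum>(t,K)\<in>p - q. ?\<Delta> K) + (\<Sum>(t,K)\<in>q. ?\<Delta> K)"
    by (rule sum.subset_diff[OF \<open>q \<subseteq> p\<close> \<open>finite p\<close>])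
  also have "\<dots> \<le> e * (b - a + 2)"
    using pq_le q_le by (simp add: algebra_simps)
  also have "\<dots> = e0"
    using \<open>a \<le> b\<close> by (simp add: e_def)
  finally show "f b - f a \<le> m * (b - a) + e0"
    by (simp add: algebra_simps)
qed

section \<open>Decay of a nonnegative scalar function\<close>

text \<open>\<open>W\<close> is nonincreasing, and as long as it stays above \<open>e\<close> it
  falls with slope at most \<open>- c * e\<close>, which nonnegativity permits only for a finite
  time.\<close>

lemma decay_imp_tendsto_zero:
  fixes W :: "real \<Rightarrow> real"
  assumes nonneg: "\<And>t. 0 \<le> t \<Longrightarrow> 0 \<le> W t"
    and ac: "\<And>T. 0 \<le> T \<Longrightarrow> absolutely_continuous_on {0..T} W"
    and "c > 0"
    and ae: "AE t in lebesgue. 0 \<le> t \<longrightarrow>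
      (\<exists>D. (W has_real_derivative D) (at t within {0..}) \<and> D \<le> - c * W t)"
  shows "(W \<longlongrightarrow> 0) at_top"
proof -
  have ac': "absolutely_continuous_on {s..t} W" if "0 \<le> s" "s \<le> t" for s t
  proof -
    have "absolutely_continuous_on {0..t} W" "{s..t} \<subseteq> {0..t}"
      using that ac by auto
    then show ?thesis
      unfolding absolutely_continuous_on_def by (meson order_trans)
  qed
  \<comment> \<open>A constant lower bound \<open>w\<close> turns the differential inequality into a
    constant slope bound. It is used with \<open>w = 0\<close> for monotonicity and with
    \<open>w = e\<close> for the contradiction.\<close>
  have incr: "W t - W s \<le> - c * w * (t - s)"
    if "0 \<le> s" "s \<le> t" and w: "\<And>r. r \<in> {s..t} \<Longrightarrow> w \<le> W r" for s t w
  proof (rule absolutely_continuous_on_increment_le[OF \<open>s \<le> t\<close> ac'[OF \<open>0 \<le> s\<close> \<open>s \<le> t\<close>]])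
    show "AE r in lebesgue. r \<in> {s..t} \<longrightarrow>
        (\<exists>D. (W has_real_derivative D) (at r within {s..t}) \<and> D \<le> - c * w)"
      using ae
    proof (rule eventually_mono, intro impI)
      fix r
      assume r: "r \<in> {s..t}" and "0 \<le> r \<longrightarrow>
        (\<exists>D. (W has_real_derivative D) (at r within {0..}) \<and> D \<le> - c * W r)"
      then obtain D where D: "(W has_real_derivative D) (at r within {0..})" "D \<le> - c * W r"
        using \<open>0 \<le> s\<close> by auto
      moreover have "c * w \<le> c * W r"
        using w[OF r] \<open>c > 0\<close> by simp
      ultimately show "\<exists>D. (W has_real_derivative D) (at r within {s..t}) \<and> D \<le> - c * w"
        using \<open>0 \<le> s\<close> DERIV_subset[OF D(1), of "{s..t}"] by (intro exI[of _ D]) auto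
    qed
  qed
  have antimono: "W t \<le> W s" if "0 \<le> s" "s \<le> t" for s t
    using incr[OF that, of 0] nonneg that by simp
  show ?thesis
    unfolding tendsto_iff
  proof (intro allI impI)
    fix e :: real
    assume "e > 0"
    have "\<exists>T\<ge>0. W T < e"
    proof (rule ccontr)
      assume "\<not> ?thesis"
      then have "\<And>r. r \<ge> 0 \<Longrightarrow> e \<le> W r"
        by (auto simp: not_less)
      \<comment> \<open>At this time the slope bound would force
        \<open>W T \<le> -1\<close>.\<close>
      moreover define T where "T = (W 0 + 1) / (c * e)"
      moreover have "T \<ge> 0"
        using nonneg[of 0] \<open>c > 0\<close> \<open>e > 0\<close> by (simp add: T_def)
      ultimately have "W T - W 0 \<le> - c * e * (T - 0)"
        by (intro incr) auto
      moreover have "c * e * T = W 0 + 1"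
        using \<open>c > 0\<close> \<open>e > 0\<close> by (simp add: T_def)
      ultimately show False
        using nonneg[OF \<open>T \<ge> 0\<close>] by simp
    qed
    then obtain T where "T \<ge> 0" "W T < e"
      by blast
    then have "dist (W t) 0 < e" if "t \<ge> T" for t
      using antimono[of T t] nonneg[of t] that by simp
    then show "\<forall>\<^sub>F t in at_top. dist (W t) 0 < e"
      by (auto simp: eventually_at_top_linorder)
  qed
qed

section \<open>Tangent cones and projected velocities\<close>

text \<open>By convexity of \<open>X\<close> the union of rays is already closed under addition and
  nonnegative scaling; taking the closure preserves this.\<close>

lemma tangent_cone_closed_convex_cone:
  assumes "convex X" "x \<in> X"
  shows "closed (tangent_cone X x)" "convex (tangent_cone X x)" "cone (tangent_cone X x)"
proof -
  define K where "K = (\<Union>y\<in>X. \<Union>l\<in>{0<..}. {l *\<^sub>R (y - x)})"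
  have "u + v \<in> K" if uv: "u \<in> K" "v \<in> K" for u v
  proof -
    obtain y l z m where yz: "y \<in> X" "z \<in> X" and lm: "l > 0" "m > 0"
      and eq: "u = l *\<^sub>R (y - x)" "v = m *\<^sub>R (z - x)"
      using uv by (auto simp: K_def)
    \<comment> \<open>Weighting by \<open>l\<close> and \<open>m\<close> makes the sum of the two
      directions a positive multiple of the single direction \<open>w - x\<close>.\<close>
    define w where "w = (l / (l + m)) *\<^sub>R y + (m / (l + m)) *\<^sub>R z"
    have "w \<in> X"
      using \<open>convex X\<close> yz lm unfolding w_def
      by (intro convexD) (auto simp flip: add_divide_distrib)
    moreover have "u + v = (l + m) *\<^sub>R (w - x)"
    proof -
      have "(l + m) *\<^sub>R w = l *\<^sub>R y + m *\<^sub>R z"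
        using lm by (simp add: w_def scaleR_add_right)
      then show ?thesis
        by (simp add: eq scaleR_diff_right scaleR_add_left)
    qed
    ultimately show ?thesis
      using lm unfolding K_def by (metis UN_I add_pos_pos greaterThan_iff singletonI)
  qed
  moreover have "c *\<^sub>R u \<in> K" if "u \<in> K" "0 \<le> c" for u c
  proof (cases "c = 0")
    case True
    have "1 *\<^sub>R (x - x) \<in> K"
      unfolding K_def using \<open>x \<in> X\<close> by (intro UN_I[of x] UN_I[of 1]) auto
    then show ?thesis
      using True by simp
  next
    case False
    obtain y l where "y \<in> X" "l > 0" "u = l *\<^sub>R (y - x)"
      using \<open>u \<in> K\<close> by (auto simp: K_def)
    then show ?thesis
      unfolding K_def using False \<open>0 \<le> c\<close> by (intro UN_I[of y] UN_I[of "c * l"]) auto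
  qed
  ultimately have "convex K" "cone K"
    using convex_cone[of K] by blast+
  then show "closed (tangent_cone X x)" "convex (tangent_cone X x)" "cone (tangent_cone X x)"
    unfolding tangent_cone_def K_def[symmetric] by (auto intro: convex_closure cone_closure)
qed

lemma diff_in_tangent_cone:
  assumes "y \<in> X"
  shows "y - x \<in> tangent_cone X x"
proof -
  have "1 *\<^sub>R (y - x) \<in> (\<Union>y\<in>X. \<Union>l\<in>{0<..}. {l *\<^sub>R (y - x)})"
    using assms by (intro UN_I[of y] UN_I[of 1]) auto
  then show ?thesis
    unfolding tangent_cone_def using closure_subset by fastforce
qed

text \<open>The residual of a projection onto a convex cone lies in the polar cone.\<close>
lemma inner_le_inner_proj_tangent:
  assumes "convex X" "x \<in> X" "y \<in> X"
  shows "(y - x) \<bullet> z \<le> (y - x) \<bullet> proj_tangent X x z"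
proof -
  let ?T = "tangent_cone X x" and ?v = "proj_tangent X x z"
  note T = tangent_cone_closed_convex_cone[OF assms(1,2)]
  have yx: "y - x \<in> ?T"
    using assms(3) by (rule diff_in_tangent_cone)
  then have "?v \<in> ?T"
    unfolding proj_tangent_def using T(1) by (intro closest_point_in_set) auto
  \<comment> \<open>Testing the projection against \<open>?v + (y - x)\<close> isolates the
    direction \<open>y - x\<close> in the obtuse-angle inequality.\<close>
  then have "?v + (y - x) \<in> ?T"
    using T(2,3) yx convex_cone[of ?T] by blast
  then have "(z - ?v) \<bullet> (?v + (y - x) - ?v) \<le> 0"
    unfolding proj_tangent_def using T(1,2) by (intro closest_point_dot) auto
  then show ?thesis
    by (simp add: inner_diff_left inner_diff_right inner_commute)
qed

section \<open>Existence and uniqueness for the variational inequality\<close>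

text \<open>A solution is a fixed point of the contraction sending x to the projection of h x.\<close>
lemma SOL_contraction_singleton:
  fixes h :: "real^'n \<Rightarrow> real^'n"
  assumes X: "closed X" "convex X" "X \<noteq> {}"
    and c: "0 \<le> c" "c < 1" and h: "\<And>x y. norm (h x - h y) \<le> c * norm (x - y)"
  shows "\<exists>z. SOL X (\<lambda>x. x - h x) = {z}"
proof -
  have "\<exists>!x\<in>X. closest_point X (h x) = x"
  proof (rule Banach_fix[OF _ X(3) c])
    show "complete X"
      using X(1) by (simp add: complete_eq_closed)
    show "(\<lambda>x. closest_point X (h x)) ` X \<subseteq> X"
      using X closest_point_in_set by blast
    show "dist (closest_point X (h x)) (closest_point X (h y)) \<le> c * dist x y" for x y
      using closest_point_lipschitz[OF X(2,1,3), of "h x" "h y"] h[of x y] by (simp add: dist_norm)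
  qed
  then obtain z where z: "z \<in> X" "closest_point X (h z) = z"
    by blast
  \<comment> \<open>The obtuse-angle property of the projection of \<open>h z\<close> at the fixed
    point \<open>z\<close> is the variational inequality itself.\<close>
  then have zS: "z \<in> SOL X (\<lambda>x. x - h x)"
    using closest_point_dot[OF X(2,1), of _ "h z"]
    by (fastforce simp: SOL_def inner_commute inner_diff_left inner_diff_right)
  have "y = z" if "y \<in> SOL X (\<lambda>x. x - h x)" for y
  proof -
    \<comment> \<open>Each solution is tested against the other; the sum of the two inequalities
      contradicts contraction unless they coincide.\<close>
    have "0 \<le> (z - y) \<bullet> (y - h y)" "0 \<le> (y - z) \<bullet> (z - h z)"
      using that zS by (auto simp: SOL_def)
    then have "(norm (y - z))\<^sup>2 \<le> (y - z) \<bullet> (h y - h z)"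
      by (simp add: power2_norm_eq_inner inner_diff_left inner_diff_right inner_commute)
    also have "\<dots> \<le> norm (y - z) * norm (h y - h z)"
      by (rule norm_cauchy_schwarz)
    also have "\<dots> \<le> norm (y - z) * (c * norm (y - z))"
      by (intro mult_left_mono h) auto
    finally have "(1 - c) * (norm (y - z))\<^sup>2 \<le> 0"
      by (simp add: algebra_simps power2_eq_square)
    then show "y = z"
      using c(2) by (simp add: mult_le_0_iff)
  qed
  with zS show ?thesis
    by blast
qed

section \<open>Gain of the transpose, the action space, and the maps F and H\<close>

text \<open>The squared norm of \<open>transpose A *v v\<close> equals the inner product of
  \<open>v\<close> with \<open>A *v (transpose A *v v)\<close>; Cauchy-Schwarz and cancellation give
  the same gain.\<close>

lemma norm_transpose_mult_le:
  fixes A :: "real^'n^'n"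
  assumes "\<And>v. norm (A *v v) \<le> k * norm v"
  shows "norm (transpose A *v v) \<le> k * norm v"
proof (cases "transpose A *v v = 0")
  case True
  \<comment> \<open>The right-hand side is nonnegative because it bounds
    \<open>norm (A *v v)\<close>.\<close>
  then show ?thesis
    using order_trans[OF norm_ge_zero assms[of v]] by simp
next
  case False
  let ?w = "transpose A *v v"
  have "norm ?w * norm ?w = v \<bullet> (A *v ?w)"
    using dot_lmul_matrix[of v A ?w] by (simp add: dot_square_norm power2_eq_square)
  also have "\<dots> \<le> norm v * (k * norm ?w)"
    by (intro order_trans[OF norm_cauchy_schwarz] mult_left_mono assms) auto
  finally have "norm ?w * norm ?w \<le> (k * norm v) * norm ?w"
    by (simp add: mult_ac)
  then show ?thesis
    using False by simp
qed

lemma action_space_closed_convex_nonempty: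
  assumes "\<And>i. Xi i \<noteq> {} \<and> closed (Xi i) \<and> convex (Xi i)"
  shows "closed (action_space Xi)" "convex (action_space Xi)" "action_space Xi \<noteq> {}"
proof -
  have "action_space Xi = (\<Inter>i. (\<lambda>x. x $ i) -` Xi i)"
    by (auto simp: action_space_def)
  then show "closed (action_space Xi)"
    using assms by (auto intro!: closed_INT closed_vimage continuous_intros)
  show "convex (action_space Xi)"
    using assms by (auto simp: action_space_def convex_def)
  have "(\<chi> i. SOME r. r \<in> Xi i) \<in> action_space Xi"
    using assms by (simp add: action_space_def some_in_eq)
  then show "action_space Xi \<noteq> {}"
    by blast
qed

lemma Fmap_eq: "Fmap a P b x = x - (a *\<^sub>R P) *v x - b"
  by (simp add: Fmap_def matrix_vector_mult_diff_rdistrib)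

text \<open>This is the form identity minus \<open>h\<close> to which
  \<open>SOL_contraction_singleton\<close> applies.\<close>

lemma Hmap_eq: "Hmap a P b x = x - ((a *\<^sub>R P) *v x + transpose (a *\<^sub>R P) *v x + b)"
proof -
  have "a *\<^sub>R (P + transpose P) = a *\<^sub>R P + transpose (a *\<^sub>R P)"
    by (simp add: vec_eq_iff transpose_def algebra_simps)
  then show ?thesis
    unfolding Hmap_def
    by (simp only: matrix_vector_mult_diff_rdistrib matrix_vector_mult_add_rdistrib
        matrix_vector_mul_lid diff_diff_eq)
qed

lemma scaleR_transpose_mult: "a *\<^sub>R (transpose P *v x) = transpose (a *\<^sub>R P) *v x" for P :: "real^'n^'n"
proof -
  have "transpose (a *\<^sub>R P) = a *\<^sub>R transpose P"
    by (simp add: vec_eq_iff transpose_def)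
  then show ?thesis
    by (simp only: scaleR_matrix_vector_assoc)
qed

text \<open>The intervention a P^T x_opt turns the optimality condition for H into an equilibrium
  condition for F; the projection onto U and P^T each cost at most one factor of the gain of aP.\<close>
lemma closed_loop_dissipation:
  fixes P :: "real^'n^'n"
  assumes k: "\<And>v. norm ((a *\<^sub>R P) *v v) \<le> k * norm v"
    and X: "convex X" "x \<in> X" and z: "z \<in> SOL X (Hmap a P b)"
    and U: "closed U" "convex U" and zU: "a *\<^sub>R (transpose P *v z) \<in> U"
    and u: "u = closest_point U (a *\<^sub>R (transpose P *v x))"
  shows "(x - z) \<bullet> proj_tangent X x (- Fmap a P b x + u) \<le> - (1 - 2 * k) * (norm (x - z))\<^sup>2"
proof -
  let ?A = "a *\<^sub>R P" and ?d = "x - z"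
  let ?w = "transpose ?A *v z"
  note k' = norm_transpose_mult_le[OF k]
  have zX: "z \<in> X" and VI: "0 \<le> ?d \<bullet> (z - (?A *v z + ?w + b))"
    using z X(2) by (auto simp: SOL_def Hmap_eq)
  have "?w \<in> U"
    using zU by (simp only: scaleR_transpose_mult)
  \<comment> \<open>As a point of \<open>U\<close>, \<open>?w\<close> is its own projection, so
    \<open>u - ?w\<close> is a difference of two projections.\<close>
  then have "norm (u - ?w) = dist (closest_point U (transpose ?A *v x)) (closest_point U ?w)"
    using u by (simp only: scaleR_transpose_mult closest_point_self dist_norm)
  also have "\<dots> \<le> dist (transpose ?A *v x) ?w"
    using U \<open>?w \<in> U\<close> by (intro closest_point_lipschitz) auto
  also have "\<dots> \<le> k * norm ?d"
    using k'[of ?d] by (simp only: dist_norm matrix_vector_mult_diff_distrib)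
  finally have "?d \<bullet> (u - ?w) \<le> norm ?d * (k * norm ?d)"
    by (intro order_trans[OF norm_cauchy_schwarz] mult_left_mono) auto
  moreover have "?d \<bullet> (?A *v ?d) \<le> norm ?d * (k * norm ?d)"
    by (intro order_trans[OF norm_cauchy_schwarz] mult_left_mono k) auto
  ultimately have gain: "?d \<bullet> (?A *v ?d) + ?d \<bullet> (u - ?w) \<le> 2 * k * (norm ?d)\<^sup>2"
    by (simp add: power2_eq_square mult_ac)
  have "(z - x) \<bullet> (- Fmap a P b x + u) \<le> (z - x) \<bullet> proj_tangent X x (- Fmap a P b x + u)"
    by (rule inner_le_inner_proj_tangent[OF X zX])
  then have "?d \<bullet> proj_tangent X x (- Fmap a P b x + u) \<le> ?d \<bullet> (- Fmap a P b x + u)"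
    by (simp add: inner_diff_left)
  \<comment> \<open>Adding the inequality at \<open>z\<close> cancels \<open>b\<close> and leaves
    only differences between the states and between the inputs.\<close>
  also have "\<dots> \<le> ?d \<bullet> (- Fmap a P b x + u) + ?d \<bullet> (z - (?A *v z + ?w + b))"
    using VI by simp
  also have "\<dots> = ?d \<bullet> (- Fmap a P b x + u + (z - (?A *v z + ?w + b)))"
    by (simp only: inner_add_right)
  also have "- Fmap a P b x + u + (z - (?A *v z + ?w + b)) = - ?d + ?A *v ?d + (u - ?w)"
    by (simp only: Fmap_eq matrix_vector_mult_diff_distrib) (simp add: algebra_simps)
  also have "?d \<bullet> (- ?d + ?A *v ?d + (u - ?w)) = - (norm ?d)\<^sup>2 + (?d \<bullet> (?A *v ?d) + ?d \<bullet> (u - ?w))"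
    by (simp only: inner_add_right inner_minus_right power2_norm_eq_inner add.assoc)
  also have "\<dots> \<le> - (1 - 2 * k) * (norm ?d)\<^sup>2"
    using gain by (simp add: algebra_simps)
  finally show ?thesis .
qed


section \<open>Convergence of the closed loop\<close>

theorem mainTheorem3:
  fixes P :: "real^'n^'n" and a :: real and b :: "real^'n"
    and Xi :: "'n \<Rightarrow> real set" and U :: "(real^'n) set"
    and x u :: "real \<Rightarrow> real^'n" and x0 :: "real^'n"
  defines "X \<equiv> action_space Xi"
    and "x_opt \<equiv> social_optimum a P b (action_space Xi)"
  assumes P_range: "\<And>i j. P $ i $ j \<in> {0..1}"
    and P_diag: "\<And>i. P $ i $ i = 0"
    and a_nonzero: "a \<noteq> 0"
    and Xi: "\<And>i. Xi i \<noteq> {} \<and> closed (Xi i) \<and> convex (Xi i)"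
    and U: "U \<noteq> {}" "closed U" "convex U" "0 \<in> U"
    and eig: "(MAX l\<in>eigenvalues (P + transpose P). a * l) < 1"
    and opt_steerable: "x_opt \<in> steerable_set a P b X U"
    and opt_intervention: "a *\<^sub>R (transpose P *v x_opt) \<in> U"
    and small_gain: "spectral_norm (a *\<^sub>R P) < 1 / 2"
    and x0: "x0 \<in> X"
    and sol: "pseudo_gradient_solution a P b X u x" "x 0 = x0"
    and feedback: "\<And>t. t \<ge> 0 \<Longrightarrow> u t = closest_point U (a *\<^sub>R (transpose P *v x t))"
  shows "(x \<longlongrightarrow> x_opt) at_top"
proof -
  define k where "k = spectral_norm (a *\<^sub>R P)"
  have k: "norm ((a *\<^sub>R P) *v v) \<le> k * norm v" for v
    unfolding k_def spectral_norm_def by (rule onorm) (rule matrix_vector_mul_bounded_linear)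
  have "0 \<le> k"
    unfolding k_def spectral_norm_def by (rule onorm_pos_le) (rule matrix_vector_mul_bounded_linear)
  have "k < 1 / 2"
    using small_gain by (simp add: k_def)
  have X: "closed X" "convex X" "X \<noteq> {}"
    unfolding X_def by (rule action_space_closed_convex_nonempty[OF Xi])+
  let ?h = "\<lambda>x. (a *\<^sub>R P) *v x + transpose (a *\<^sub>R P) *v x + b"
  \<comment> \<open>\<open>2 * k < 1\<close> makes \<open>?h\<close> a contraction, so the solution
    set is a singleton and \<open>the_elem\<close> in \<open>social_optimum\<close> returns an
    actual solution.\<close>
  have "norm (?h x - ?h y) \<le> (2 * k) * norm (x - y)" for x y
  proof -
    have "?h x - ?h y = (a *\<^sub>R P) *v (x - y) + transpose (a *\<^sub>R P) *v (x - y)"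
      by (simp only: matrix_vector_mult_diff_distrib) (simp add: algebra_simps)
    then have "norm (?h x - ?h y) \<le> k * norm (x - y) + k * norm (x - y)"
      using norm_triangle_mono[OF k[of "x - y"] norm_transpose_mult_le[OF k, of "x - y"]]
      by (simp only:)
    then show ?thesis
      by simp
  qed
  then obtain z where "SOL X (\<lambda>x. x - ?h x) = {z}"
    using SOL_contraction_singleton[OF X, of "2 * k" ?h] \<open>0 \<le> k\<close> \<open>k < 1 / 2\<close> by force
  moreover have "Hmap a P b = (\<lambda>x. x - ?h x)"
    by (intro ext Hmap_eq)
  ultimately have z: "SOL X (Hmap a P b) = {z}"
    by (simp only:)
  then have "x_opt = z"
    by (simp only: x_opt_def social_optimum_def X_def the_elem_eq)
  with z have opt: "x_opt \<in> SOL X (Hmap a P b)"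
    by simp

  let ?W = "\<lambda>t. (norm (x t - x_opt))\<^sup>2"
  have xX: "x t \<in> X" if "0 \<le> t" for t
    using sol that by (simp add: pseudo_gradient_solution_def)
  have "(?W \<longlongrightarrow> 0) at_top"
  proof (rule decay_imp_tendsto_zero)
    \<comment> \<open>The outer factor 2 comes from differentiating the squared norm.\<close>
    show "2 * (1 - 2 * k) > 0"
      using \<open>k < 1 / 2\<close> by simp
    show "absolutely_continuous_on {0..T} ?W" if "0 \<le> T" for T
      using sol that
      by (intro absolutely_continuous_on_norm_diff_squared) (simp add: pseudo_gradient_solution_def)
    have "AE t in lebesgue. 0 \<le> t \<longrightarrow>
        (x has_vector_derivative proj_tangent X (x t) (- Fmap a P b (x t) + u t)) (at t within {0..})"
      using sol by (simp add: pseudo_gradient_solution_def)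
    then show "AE t in lebesgue. 0 \<le> t \<longrightarrow>
        (\<exists>D. (?W has_real_derivative D) (at t within {0..}) \<and> D \<le> - (2 * (1 - 2 * k)) * ?W t)"
    proof (rule eventually_mono, intro impI)
      fix t :: real
      let ?v = "proj_tangent X (x t) (- Fmap a P b (x t) + u t)"
      assume t: "0 \<le> t" and "0 \<le> t \<longrightarrow> (x has_vector_derivative ?v) (at t within {0..})"
      then have "((\<lambda>t. (x t - x_opt) \<bullet> (x t - x_opt)) has_real_derivative
          2 * ((x t - x_opt) \<bullet> ?v)) (at t within {0..})"
        unfolding has_vector_derivative_def has_field_derivative_def
        by (auto intro!: derivative_eq_intros simp: inner_commute algebra_simps fun_eq_iff)
      moreover have "(x t - x_opt) \<bullet> ?v \<le> - (1 - 2 * k) * ?W t"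
        using closed_loop_dissipation[OF k X(2) xX[OF t] opt U(2,3) opt_intervention feedback[OF t]] .
      then have "2 * ((x t - x_opt) \<bullet> ?v) \<le> - (2 * (1 - 2 * k)) * ?W t"
        by linarith
      ultimately show "\<exists>D. (?W has_real_derivative D) (at t within {0..}) \<and> D \<le> - (2 * (1 - 2 * k)) * ?W t"
        unfolding power2_norm_eq_inner by blast
    qed
  qed simp
  then have "((\<lambda>t. sqrt (?W t)) \<longlongrightarrow> sqrt 0) at_top"
    by (rule tendsto_real_sqrt)
  then show ?thesis
    by (subst Lim_null) (simp add: tendsto_norm_zero_iff)
qed

end
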